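(* Let $\lambda$ be a nonzero real number. For all integers $n,k\ge 0$ with $n\ge k$, \[ S_{J,\lambda}^{(2)}(n,k)=\sum_{m=k}^{n}S_{2,\lambda}(n,m)\,S_{2,\lambda}(m,k). \]
   Context: For a nonzero real $\lambda$, set $(x)_{0,\lambda}=1$ and $(x)_{n,\lambda}=x(x-\lambda)(x-2\lambda)\cdots(x-(n-1)\lambda)$ for $n\ge1$. The degenerate exponential functions are the formal power series $e_\lambda^x(t)=\sum_{n\ge0}(x)_{n,\lambda}\frac{t^n}{n!}$ (equal to $(1+\lambda t)^{x/\lambda}$), and $e_\lambda(t)=e_\lambda^1(t)$. The degenerate Stirling numbers of the second kind $S_{2,\lambda}(n,k)$ are defined by $\frac{1}{k!}(e_\lambda(t)-1)^k=\sum_{n\ge k}S_{2,\lambda}(n,k)\frac{t^n}{n!}$ for $k\ge0$. The Jindalrae-Stirling numbers of the second kind $S_{J,\lambda}^{(2)}(n,k)$ are defined by $\frac{1}{k!}\big(e_\lambda(e_\lambda(t)-1)-1\big)^k=\sum_{n\ge k}S_{J,\lambda}^{(2)}(n,k)\frac{t^n}{n!}$ for $k\ge 0$. *)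

theory Defs
  imports "HOL-Computational_Algebra.Formal_Power_Series"
begin

definition deg_falling :: "real \<Rightarrow> real \<Rightarrow> nat \<Rightarrow> real" where
  "deg_falling l x n = (\<Prod>i<n. x - real i * l)"

definition deg_exp_pow :: "real \<Rightarrow> real \<Rightarrow> real fps" where
  "deg_exp_pow l x = Abs_fps (\<lambda>n. deg_falling l x n / fact n)"

definition deg_exp :: "real \<Rightarrow> real fps" where
  "deg_exp l = deg_exp_pow l 1"

text \<open>
  The numbers are read off their exponential generating functions. The lemmas
  \<open>deg_stirling2_egf\<close> and \<open>jindalrae_stirling2_egf\<close> below confirm that these
  series start at \<open>n = k\<close>, as their defining equations require.
\<close>

definition deg_stirling2 :: "real \<Rightarrow> nat \<Rightarrow> nat \<Rightarrow> real" where
  "deg_stirling2 l n k =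
     fact n * fps_nth (fps_const (1 / fact k) * (deg_exp l - 1) ^ k) n"

text \<open>
  The composition is genuine substitution, since \<open>deg_exp l - 1\<close> has constant term zero.
\<close>

definition jindalrae_stirling2 :: "real \<Rightarrow> nat \<Rightarrow> nat \<Rightarrow> real" where
  "jindalrae_stirling2 l n k =
     fact n * fps_nth (fps_const (1 / fact k) * ((deg_exp l oo (deg_exp l - 1)) - 1) ^ k) n"

lemma deg_exp_nth_0 [simp]: "fps_nth (deg_exp l) 0 = 1"
  by (simp add: deg_exp_def deg_exp_pow_def deg_falling_def)

lemma deg_stirling2_egf:
  "fps_const (1 / fact k) * (deg_exp l - 1) ^ k =
     Abs_fps (\<lambda>n. if n \<ge> k then deg_stirling2 l n k / fact n else 0)"
  by (rule fps_ext) (simp add: deg_stirling2_def startsby_zero_power_prefix)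

lemma jindalrae_stirling2_egf:
  "fps_const (1 / fact k) * ((deg_exp l oo (deg_exp l - 1)) - 1) ^ k =
     Abs_fps (\<lambda>n. if n \<ge> k then jindalrae_stirling2 l n k / fact n else 0)"
  by (rule fps_ext) (simp add: jindalrae_stirling2_def startsby_zero_power_prefix)

end

theory Submission
  imports Defs
begin

text \<open>
  With \<open>f = deg_exp l - 1\<close>, the generating function of the Jindalrae-Stirling numbers is
  \<open>(f oo f) ^ k / k! = (f ^ k / k!) oo f\<close>; expanding the outer series in powers of \<open>f\<close>
  and comparing coefficients gives the convolution.
\<close>

theorem theorem1:
  fixes l :: real and n k :: nat
  assumes "l \<noteq> 0" and "n \<ge> k"
  shows "jindalrae_stirling2 l n k = (\<Sum>m=k..n. deg_stirling2 l n m * deg_stirling2 l m k)"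
proof -
  define f where "f = deg_exp l - 1"
  have f0: "fps_nth f 0 = 0"
    by (simp add: f_def)
  \<comment> \<open>Substitution is additive and fixes the constant 1.\<close>
  have "(deg_exp l oo f) - 1 = f oo f"
    by (simp add: f_def fps_compose_sub_distrib)
  then have "((deg_exp l oo f) - 1) ^ k = f ^ k oo f"
    by (simp add: fps_compose_power[OF f0])
  then have "jindalrae_stirling2 l n k =
      (\<Sum>m=0..n. fact n / fact k * (fps_nth (f ^ k) m * fps_nth (f ^ m) n))"
    by (simp add: jindalrae_stirling2_def f_def fps_compose_nth sum_distrib_left)
  \<comment> \<open>The terms with \<open>m < k\<close> vanish: \<open>f\<close> has zero constant
    term, so \<open>f ^ k\<close> has no coefficient below degree \<open>k\<close>.\<close>
  also have "\<dots> = (\<Sum>m=k..n. fact n / fact k * (fps_nth (f ^ k) m * fps_nth (f ^ m) n))"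
    by (rule sum.mono_neutral_right) (auto simp: startsby_zero_power_prefix[OF f0])
  \<comment> \<open>The factor \<open>1 / fact m\<close> in \<open>deg_stirling2 l n m\<close>
    cancels the \<open>fact m\<close> in \<open>deg_stirling2 l m k\<close>, leaving
    \<open>fact n / fact k\<close>.\<close>
  also have "\<dots> = (\<Sum>m=k..n. deg_stirling2 l n m * deg_stirling2 l m k)"
    by (rule sum.cong) (simp_all add: deg_stirling2_def f_def)
  finally show ?thesis .
qed

end
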